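(* Let $\mathcal{H}$ be a real Hilbert space, let $S\subseteq\mathcal{H}$ be any nonempty subset, and let $\alpha:S\to\mathbb{R}$ and $v:S\to\mathcal{H}$ be such that, for some constant $M>0$, $$\alpha(s_{2})\geq\alpha(s_{1})+\langle v(s_{1}),s_{2}-s_{1}\rangle+\frac{1}{2M}|v(s_{1})-v(s_{2})|^{2}\qquad\text{for all } s_{1},s_{2}\in S.$$ Then the following hold. (1) The function $$f(x)=\sup_{s\in S}\,\{\alpha(s)+\langle v(s),x-s\rangle\},\qquad x\in\mathcal{H},$$ is the smallest continuous convex extension of $(\alpha,v)$ in $\mathcal{H}$; that is, $f$ is a real-valued continuous convex function on $\mathcal{H}$, differentiable at every point of $S$, with $f(s)=\alpha(s)$ and $\nabla f(s)=v(s)$ for all $s\in S$, and if $g:\mathcal{H}\to\mathbb{R}$ is any continuous convex function that is differentiable at every point of $S$ and satisfies $g(s)=\alpha(s)$, $\nabla g(s)=v(s)$ for all $s\in S$, then $f\le g$ on $\mathcal{H}$. (2) The function $$F(x)=\lim_{\varepsilon\nearrow\frac{1}{M}}(f^{\varepsilon})_{\varepsilon}(x)=\lim_{\varepsilon\nearrow\frac{1}{M}}\ \inf_{z\in\mathcal{H}}\ \sup_{y\in\mathcal{H}}\Big\{f(y)-\frac{|y-z|^{2}}{2\varepsilon}+\frac{|z-x|^{2}}{2\varepsilon}\Big\},\qquad x\in\mathcal{H},$$ is a $C^{1,1}$ convex extension of $(\alpha,v)$ in $\mathcal{H}$; that is, $F:\mathcal{H}\to\mathbb{R}$ is well defined,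 convex, differentiable on $\mathcal{H}$ with Lipschitz continuous gradient, and $F(s)=\alpha(s)$, $\nabla F(s)=v(s)$ for all $s\in S$. Moreover, $\mathrm{Lip}(\nabla F)\leq M$.
   Context: $\langle\cdot,\cdot\rangle$ and $|\cdot|$ denote the inner product and norm of $\mathcal{H}$. For $h:\mathcal{H}\to\mathbb{R}$ and $\varepsilon>0$, the sup-convolution and inf-convolution of $h$ are $$h^{\varepsilon}(x)=\sup_{y\in\mathcal{H}}\Big\{h(y)-\frac{|y-x|^{2}}{2\varepsilon}\Big\},\qquad h_{\varepsilon}(x)=\inf_{y\in\mathcal{H}}\Big\{h(y)+\frac{|y-x|^{2}}{2\varepsilon}\Big\}.$$ Thus $(f^{\varepsilon})_{\varepsilon}$ is the inf-convolution (with parameter $\varepsilon$) of the sup-convolution (with parameter $\varepsilon$) of $f$. The notation $\varepsilon\nearrow\frac1M$ means that $\varepsilon$ tends to $\frac1M$ from below, with $\varepsilon\in(0,\frac1M)$. $\mathrm{Lip}(\nabla F)$ denotes the best Lipschitz constant of $\nabla F:\mathcal{H}\to\mathcal{H}$. *)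

theory Defs
  imports "HOL-Analysis.Analysis"
begin

text \<open>
  For real \<open>h\<close> the convolutions may be infinite, and the inf-convolution is applied to a
  sup-convolution; both are therefore operators on extended-real-valued functions.
\<close>

definition sup_conv :: "real \<Rightarrow> ('a::real_inner \<Rightarrow> ereal) \<Rightarrow> 'a \<Rightarrow> ereal" where
  "sup_conv \<epsilon> h x = (SUP y. h y - ereal ((norm (y - x))\<^sup>2 / (2 * \<epsilon>)))"

definition inf_conv :: "real \<Rightarrow> ('a::real_inner \<Rightarrow> ereal) \<Rightarrow> 'a \<Rightarrow> ereal" where
  "inf_conv \<epsilon> h x = (INF y. h y + ereal ((norm (y - x))\<^sup>2 / (2 * \<epsilon>)))"

text \<open>
  This is a supremum in \<^typ>\<open>real\<close>, hence meaningful only if the family is bounded above.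
\<close>

definition jet_sup :: "'a::real_inner set \<Rightarrow> ('a \<Rightarrow> real) \<Rightarrow> ('a \<Rightarrow> 'a) \<Rightarrow> 'a \<Rightarrow> real" where
  "jet_sup S \<alpha> v x = (SUP s\<in>S. \<alpha> s + v s \<bullet> (x - s))"

text \<open>
  The value is meaningful only if the limit exists and is finite.
\<close>

definition lim_sup_inf_conv :: "real \<Rightarrow> ('a::real_inner \<Rightarrow> real) \<Rightarrow> 'a \<Rightarrow> real" where
  "lim_sup_inf_conv M f x =
     real_of_ereal (Lim (at_left (1 / M)) (\<lambda>\<epsilon>. inf_conv \<epsilon> (sup_conv \<epsilon> (\<lambda>y. ereal (f y))) x))"

text \<open>
  \<open>GDERIV f s :> D\<close> says that \<open>f\<close> is (Frechet) differentiable at \<open>s\<close> with gradient \<open>D\<close>.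
\<close>

definition extends_jet ::
  "'a::real_inner set \<Rightarrow> ('a \<Rightarrow> real) \<Rightarrow> ('a \<Rightarrow> 'a) \<Rightarrow> ('a \<Rightarrow> real) \<Rightarrow> bool" where
  "extends_jet S \<alpha> v f \<longleftrightarrow> (\<forall>s\<in>S. f s = \<alpha> s \<and> GDERIV f s :> v s)"

definition gradient :: "('a::real_inner \<Rightarrow> real) \<Rightarrow> 'a \<Rightarrow> 'a" where
  "gradient f x = (THE D. GDERIV f x :> D)"

text \<open>
  The best Lipschitz constant; meaningful only for Lipschitz \<open>G\<close>, since otherwise the
  infimum is over the empty set.
\<close>

definition Lip :: "('a::metric_space \<Rightarrow> 'b::metric_space) \<Rightarrow> real" where
  "Lip G = Inf {L. L-lipschitz_on UNIV G}"

end

theory Submission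
  imports Defs
begin

text \<open>
  Everything rests on comparing \<open>f\<close> from below with affine functions and from above with
  quadratic functions of curvature \<open>c\<close>, that is, functions
  \<open>y \<mapsto> a + p \<bullet> (y - x) + c / 2 * |y - x|\<^sup>2\<close>.  Completing a square in the hypothesis
  on \<open>(\<alpha>, v)\<close> shows that at every \<open>s \<in> S\<close> the supremum \<open>f\<close> lies between
  \<open>\<alpha> s + v s \<bullet> (y - s)\<close> and the same function plus \<open>M / 2 * |y - s|\<^sup>2\<close>
  (\<open>jet_sup_minorant\<close>, \<open>jet_sup_majorant\<close>).  This makes \<open>f\<close> finite, locally bounded and hence
  continuous, and gives it the prescribed value and gradient on \<open>S\<close>; minimality holds because a
  convex function lies above its tangents.

  For the second part, substitute \<open>z = x - \<epsilon> p\<close> in the double convolution.  The terms in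
  \<open>|z - x|\<^sup>2\<close> cancel, and \<open>(f\<^sup>\<epsilon>)\<^sub>\<epsilon> (x)\<close> turns out to be the infimum of the values at \<open>x\<close>
  of all quadratic functions of curvature \<open>1 / \<epsilon>\<close> above \<open>f\<close>
  (\<open>inf_sup_conv_eq_quad_env\<close>).  Since the whole class of such quadratics does not depend on the
  centre, this envelope again lies below each of them; it is convex when \<open>f\<close> is, lies above
  \<open>f\<close>, and decreases when the curvature grows.  So the limit for \<open>\<epsilon>\<close> increasing to
  \<open>1 / M\<close> is a supremum, is convex, and inherits the two bounds at the points of \<open>S\<close>.

  The remaining point is regularity.  Each envelope has, at every \<open>x\<close>, quadratic majorants which
  touch it up to an arbitrarily small error.  Convexity forces the slopes of almost touching
  majorants to be close to each other, so along the monotone limit they form a Cauchy sequence, and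
  by completeness the limit \<open>F\<close> has an exactly touching majorant of curvature \<open>M\<close> at every
  point (\<open>limit_quad_majorant\<close>).  For a convex function the slope of such a majorant is also
  the slope of an affine minorant (\<open>convex_quad_majorant_tangent\<close>).  The two bounds together give
  differentiability and, by the cocoercivity argument in \<open>cocoercive_supports\<close>, an \<open>M\<close>-Lipschitz
  gradient.
\<close>

section \<open>Affine supports and quadratic majorants\<close>

lemma norm_add_sq: "(norm (a + b))\<^sup>2 = (norm a)\<^sup>2 + 2 * (a \<bullet> b) + (norm (b::'a::real_inner))\<^sup>2"
  by (simp add: power2_norm_eq_inner algebra_simps inner_commute)

lemma inner_minus_square_le:
  fixes p d :: "'a::real_inner"
  assumes "k > 0"
  shows "p \<bullet> d - k / 2 * (norm d)\<^sup>2 \<le> (norm p)\<^sup>2 / (2 * k)"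
proof -
  have "0 \<le> (norm (p + (- k) *\<^sub>R d))\<^sup>2 / (2 * k)" using assms by simp
  also have "\<dots> = (norm p)\<^sup>2 / (2 * k) - p \<bullet> d + k / 2 * (norm d)\<^sup>2"
    unfolding norm_add_sq using assms
    by (simp add: power_mult_distrib add_divide_distrib diff_divide_distrib) (simp add: power2_eq_square field_simps)
  finally show ?thesis by simp
qed

text \<open>
  The displacement \<open>d = - q / (2 C)\<close> minimises the right-hand side.
\<close>

lemma norm_sq_le_of_quadratic:
  fixes q :: "'a::real_inner"
  assumes "C > 0" and "\<And>d. 0 \<le> e + q \<bullet> d + C * (norm d)\<^sup>2"
  shows "(norm q)\<^sup>2 \<le> 4 * C * e"
proof -
  have "0 \<le> e + q \<bullet> ((- 1 / (2 * C)) *\<^sub>R q) + C * (norm ((- 1 / (2 * C)) *\<^sub>R q))\<^sup>2"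
    by (rule assms(2))
  also have "\<dots> = e - (norm q)\<^sup>2 / (4 * C)"
    using assms(1) by (simp add: power_mult_distrib power2_norm_eq_inner[symmetric] power_divide)
      (simp add: power2_eq_square field_simps)
  finally show ?thesis using assms(1) by (simp add: field_simps)
qed

text \<open>
  Both bounds are stated in the displacement \<open>d\<close> from the centre \<open>x\<close>, and the value \<open>a\<close> at the
  centre is a separate argument because majorants that do not touch \<open>f\<close> are needed as well.
\<close>

definition affine_minorant :: "('a::real_inner \<Rightarrow> real) \<Rightarrow> 'a \<Rightarrow> real \<Rightarrow> 'a \<Rightarrow> bool" where
  "affine_minorant f x a p \<longleftrightarrow> (\<forall>d. a + p \<bullet> d \<le> f (x + d))"

definition quad_majorant :: "real \<Rightarrow> ('a::real_inner \<Rightarrow> real) \<Rightarrow> 'a \<Rightarrow> real \<Rightarrow> 'a \<Rightarrow> bool" where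
  "quad_majorant c f x a p \<longleftrightarrow> (\<forall>d. f (x + d) \<le> a + p \<bullet> d + c / 2 * (norm d)\<^sup>2)"

text \<open>
  The class of quadratic functions with leading coefficient \<open>c / 2\<close> is the same around every
  centre; this is why an envelope of such functions is again bounded by each of them.
\<close>

lemma quad_majorant_recenter:
  assumes "quad_majorant c f s a p"
  shows "quad_majorant c f (s + e) (a + p \<bullet> e + c / 2 * (norm e)\<^sup>2) (p + c *\<^sub>R e)"
  unfolding quad_majorant_def
proof
  fix d
  have "f (s + (e + d)) \<le> a + p \<bullet> (e + d) + c / 2 * (norm (e + d))\<^sup>2"
    using assms unfolding quad_majorant_def by blast
  then show "f (s + e + d) \<le> a + p \<bullet> e + c / 2 * (norm e)\<^sup>2 + (p + c *\<^sub>R e) \<bullet> d + c / 2 * (norm d)\<^sup>2"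
    unfolding norm_add_sq by (simp add: algebra_simps)
qed

lemma affine_minorantD:
  assumes "affine_minorant f x a p"
  shows "a + p \<bullet> (y - x) \<le> f y"
  using assms[unfolded affine_minorant_def, rule_format, of "y - x"] by simp

lemma quad_majorantD:
  assumes "quad_majorant c f x a p"
  shows "f y \<le> a + p \<bullet> (y - x) + c / 2 * (norm (y - x))\<^sup>2"
  using assms[unfolded quad_majorant_def, rule_format, of "y - x"] by simp

lemma quad_majorant_mono:
  fixes f :: "'a::real_inner \<Rightarrow> real"
  assumes "quad_majorant c f x a p" "c \<le> c'"
  shows "quad_majorant c' f x a p"
  unfolding quad_majorant_def
proof
  fix d :: 'a
  have "c / 2 * (norm d)\<^sup>2 \<le> c' / 2 * (norm d)\<^sup>2" using assms(2) by (intro mult_right_mono) auto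
  then show "f (x + d) \<le> a + p \<bullet> d + c' / 2 * (norm d)\<^sup>2"
    using assms(1)[unfolded quad_majorant_def, rule_format, of d] by linarith
qed

text \<open>
  The two bounds differ by \<open>c / 2 * |d|\<^sup>2\<close>, which is \<open>o(|d|)\<close>.
\<close>

lemma GDERIV_sandwich:
  assumes lo: "affine_minorant f x (f x) p" and up: "quad_majorant c f x (f x) p"
  shows "GDERIV f x :> p"
  unfolding gderiv_def
proof (rule has_derivativeI_sandwich[where e = 1 and H = "\<lambda>y. \<bar>c\<bar> / 2 * norm (y - x)"])
  show "bounded_linear (\<lambda>h. h \<bullet> p)" by (rule bounded_linear_inner_left)
  have "((\<lambda>y. \<bar>c\<bar> / 2 * norm (y - x)) \<longlongrightarrow> \<bar>c\<bar> / 2 * norm (x - x)) (at x)"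
    by (intro tendsto_intros)
  then show "((\<lambda>y. \<bar>c\<bar> / 2 * norm (y - x)) \<longlongrightarrow> 0) (at x)" by simp
next
  fix y assume y: "y \<noteq> x"
  let ?d = "y - x"
  have "f x + p \<bullet> ?d \<le> f y" "f y \<le> f x + p \<bullet> ?d + c / 2 * (norm ?d)\<^sup>2"
    by (rule affine_minorantD[OF lo] quad_majorantD[OF up])+
  moreover have "c / 2 * (norm ?d)\<^sup>2 \<le> \<bar>c\<bar> / 2 * (norm ?d)\<^sup>2" by (intro mult_right_mono) auto
  ultimately have "norm (f y - f x - ?d \<bullet> p) \<le> \<bar>c\<bar> / 2 * (norm ?d)\<^sup>2"
    by (auto simp: inner_commute)
  then show "norm (f y - f x - ?d \<bullet> p) / norm ?d \<le> \<bar>c\<bar> / 2 * norm ?d"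
    using y by (simp add: divide_le_eq power2_eq_square mult_ac)
qed auto

lemma GDERIV_unique:
  assumes "GDERIV f x :> p" "GDERIV f x :> q"
  shows "p = q"
proof -
  have "(\<lambda>h. h \<bullet> p) = (\<lambda>h. h \<bullet> q)"
    using assms has_derivative_unique unfolding gderiv_def by blast
  then have "h \<bullet> p = h \<bullet> q" for h by (rule fun_cong)
  then show ?thesis using vector_eq_ldot[of p q] by blast
qed

lemma gradient_eqI:
  assumes "GDERIV f x :> p"
  shows "gradient f x = p"
  unfolding gradient_def
proof (rule the_equality)
  show "GDERIV f x :> p" by (rule assms)
  show "q = p" if "GDERIV f x :> q" for q by (rule GDERIV_unique[OF that assms])
qed

text \<open>
  Restriction to the line through \<open>s\<close> in direction \<open>d\<close> reduces this to the one-dimensional fact.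
\<close>

lemma convex_tangent_minorant:
  assumes g: "convex_on UNIV g" and d: "GDERIV g s :> p"
  shows "affine_minorant g s (g s) p"
  unfolding affine_minorant_def
proof
  fix d
  let ?\<phi> = "\<lambda>t::real. g (s + t *\<^sub>R d)"
  have "convex_on UNIV ?\<phi>"
  proof (rule convex_onI)
    fix t x y :: real assume "0 < t" "t < 1"
    then have "g ((1 - t) *\<^sub>R (s + x *\<^sub>R d) + t *\<^sub>R (s + y *\<^sub>R d)) \<le> (1 - t) * ?\<phi> x + t * ?\<phi> y"
      by (intro convex_onD[OF g]) auto
    then show "?\<phi> ((1 - t) *\<^sub>R x + t *\<^sub>R y) \<le> (1 - t) * ?\<phi> x + t * ?\<phi> y"
      by (simp add: algebra_simps)
  qed auto
  moreover have "((\<lambda>t. g (s + t *\<^sub>R d)) has_derivative (\<lambda>h. (h *\<^sub>R d) \<bullet> p)) (at 0)"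
    using d unfolding gderiv_def
    by (intro has_derivative_compose[where g = g and f = "\<lambda>t. s + t *\<^sub>R d"])
      (auto intro!: derivative_eq_intros)
  then have "(?\<phi> has_real_derivative d \<bullet> p) (at 0)"
    by (simp add: has_field_derivative_def mult_commute_abs)
  ultimately have "?\<phi> 1 - ?\<phi> 0 \<ge> (d \<bullet> p) * (1 - 0)"
    by (intro convex_on_imp_above_tangent[where A = UNIV]) auto
  then show "g s + p \<bullet> d \<le> g (s + d)" by (simp add: inner_commute)
qed

lemma convex_midpoint:
  assumes "convex_on UNIV f"
  shows "2 * f x \<le> f (x + d) + f (x - d)"
proof -
  have "f ((1 - 1/2) *\<^sub>R (x + d) + (1/2) *\<^sub>R (x - d)) \<le> (1 - 1/2) * f (x + d) + 1/2 * f (x - d)"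
    by (rule convex_onD[OF assms]) auto
  moreover have "(1 - 1/2) *\<^sub>R (x + d) + (1/2) *\<^sub>R (x - d) = x"
    by (simp add: algebra_simps flip: scaleR_add_left)
  ultimately show ?thesis by simp
qed

text \<open>
  The point \<open>x\<close> lies on the segment from \<open>x - t d\<close> to \<open>x + d\<close>.  Convexity together with the upper
  bound at \<open>x - t d\<close> gives the lower bound at \<open>x + d\<close> up to an error linear in \<open>t\<close>, and \<open>t\<close> tends to
  \<open>0\<close>.
\<close>

lemma convex_quad_majorant_tangent:
  assumes f: "convex_on UNIV f" and up: "quad_majorant c f x (f x) p"
  shows "affine_minorant f x (f x) p"
proof -
  have lb: "f x + p \<bullet> d - c / 2 * (norm d)\<^sup>2 * t \<le> f (x + d)" if t: "0 < t" "t < 1" for t d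
  proof -
    have "f ((1 - t / (1 + t)) *\<^sub>R (x - t *\<^sub>R d) + (t / (1 + t)) *\<^sub>R (x + d))
        \<le> (1 - t / (1 + t)) * f (x - t *\<^sub>R d) + t / (1 + t) * f (x + d)"
      using t by (intro convex_onD[OF f]) auto
    moreover have "1 - t / (1 + t) = 1 / (1 + t)" using t by (simp add: field_simps)
    moreover have "(1 / (1 + t)) *\<^sub>R (x - t *\<^sub>R d) + (t / (1 + t)) *\<^sub>R (x + d) = x"
    proof -
      have "(1 / (1 + t)) *\<^sub>R (x - t *\<^sub>R d) + (t / (1 + t)) *\<^sub>R (x + d)
          = (1 / (1 + t) + t / (1 + t)) *\<^sub>R x" by (simp add: algebra_simps)
      also have "1 / (1 + t) + t / (1 + t) = 1" using t by (simp add: field_simps)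
      finally show ?thesis by simp
    qed
    ultimately have "f x \<le> (f (x - t *\<^sub>R d) + t * f (x + d)) / (1 + t)"
      by (simp add: add_divide_distrib)
    then have "(1 + t) * f x \<le> f (x - t *\<^sub>R d) + t * f (x + d)"
      using t by (simp add: le_divide_eq mult.commute)
    also have "f (x + (- t) *\<^sub>R d) \<le> f x + p \<bullet> ((- t) *\<^sub>R d) + c / 2 * (norm ((- t) *\<^sub>R d))\<^sup>2"
      using up unfolding quad_majorant_def by blast
    then have "f (x - t *\<^sub>R d) \<le> f x - t * (p \<bullet> d) + c / 2 * (norm d)\<^sup>2 * t * t"
      by (simp add: power_mult_distrib power2_eq_square mult_ac)
    finally have "t * (f x + p \<bullet> d - c / 2 * (norm d)\<^sup>2 * t) \<le> t * f (x + d)"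
      by (simp add: algebra_simps)
    then show ?thesis using t by simp
  qed
  show ?thesis unfolding affine_minorant_def
  proof
    fix d
    have "((\<lambda>t. f x + p \<bullet> d - c / 2 * (norm d)\<^sup>2 * t)
        \<longlongrightarrow> f x + p \<bullet> d - c / 2 * (norm d)\<^sup>2 * 0) (at_right 0)"
      by (intro tendsto_intros)
    moreover have "eventually (\<lambda>t. f x + p \<bullet> d - c / 2 * (norm d)\<^sup>2 * t \<le> f (x + d)) (at_right 0)"
      unfolding eventually_at_right_field by (intro exI[of _ 1] conjI allI impI lb) simp_all
    ultimately have "f x + p \<bullet> d - c / 2 * (norm d)\<^sup>2 * 0 \<le> f (x + d)"
      by (rule tendsto_upperbound) simp
    then show "f x + p \<bullet> d \<le> f (x + d)" by simp
  qed
qed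

text \<open>
  The affine minorant at \<open>x\<close> is below the majorant at \<open>y\<close> everywhere; the gain is largest at the
  displacement \<open>(p - q) / M\<close> from \<open>y\<close>, where the majorant exceeds the minorant by the least amount.
\<close>

lemma cocoercive_supports:
  assumes M: "M > 0"
    and lo: "affine_minorant f x (f x) p" and up: "quad_majorant M f y (f y) q"
  shows "f x + p \<bullet> (y - x) + (norm (p - q))\<^sup>2 / (2 * M) \<le> f y"
proof -
  let ?d = "(1 / M) *\<^sub>R (p - q)"
  have "f x + p \<bullet> (y - x + ?d) \<le> f (y + ?d)"
    using affine_minorantD[OF lo, of "y + ?d"] by (simp add: algebra_simps)
  also have "\<dots> \<le> f y + q \<bullet> ?d + M / 2 * (norm ?d)\<^sup>2"
    using up unfolding quad_majorant_def by blast
  finally have "f x + p \<bullet> (y - x) + (p - q) \<bullet> ?d - M / 2 * (norm ?d)\<^sup>2 \<le> f y"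
    by (simp add: inner_add_right inner_diff_left algebra_simps)
  moreover have "(p - q) \<bullet> ?d - M / 2 * (norm ?d)\<^sup>2 = (norm (p - q))\<^sup>2 / (2 * M)"
    using M by (simp add: power_mult_distrib power2_norm_eq_inner[symmetric] power_divide)
      (simp add: power2_eq_square field_simps)
  ultimately show ?thesis by simp
qed

text \<open>
  Adding the cocoercivity inequality for \<open>(x, y)\<close> to the one for \<open>(y, x)\<close> yields
  \<open>|p x - p y|\<^sup>2 / M \<le> (p x - p y) \<bullet> (x - y)\<close>.
\<close>

lemma supports_lipschitz:
  assumes M: "M > 0"
    and lo: "\<And>x. affine_minorant f x (f x) (p x)" and up: "\<And>x. quad_majorant M f x (f x) (p x)"
  shows "M-lipschitz_on UNIV p"
proof (rule lipschitz_onI)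
  fix x y
  let ?n = "norm (p x - p y)"
  have "f x + p x \<bullet> (y - x) + ?n\<^sup>2 / (2 * M) \<le> f y"
    "f y + p y \<bullet> (x - y) + (norm (p y - p x))\<^sup>2 / (2 * M) \<le> f x"
    by (rule cocoercive_supports[OF M lo up])+
  then have "?n\<^sup>2 / M \<le> (p x - p y) \<bullet> (x - y)"
    using M by (simp add: norm_minus_commute inner_diff_left inner_diff_right field_simps)
  also have "\<dots> \<le> ?n * norm (x - y)" by (rule norm_cauchy_schwarz)
  finally have "?n * ?n \<le> ?n * (M * norm (x - y))"
    using M by (simp add: power2_eq_square divide_le_eq mult_ac)
  then have "?n \<le> M * norm (x - y)"
    using M by (cases "?n = 0") auto
  then show "dist (p x) (p y) \<le> M * dist x y" by (simp add: dist_norm)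
qed (use M in simp)

section \<open>Upper quadratic supports survive monotone limits\<close>

text \<open>
  The slopes \<open>p n\<close> of majorants touching \<open>u n\<close> up to \<open>1 / (n + 1)\<close> form a Cauchy sequence.  Indeed,
  for \<open>n \<le> m\<close> bound \<open>u n (x + d)\<close> by the \<open>n\<close>-th majorant and \<open>u n (x - d) \<le> u m (x - d)\<close> by the
  \<open>m\<close>-th one.  Midpoint convexity of \<open>u n\<close> turns the sum into a quadratic in \<open>d\<close>, with linear part
  \<open>p n - p m\<close>, that is nowhere negative, so \<open>|p n - p m|\<^sup>2\<close> is controlled by its constant term,
  which tends to \<open>0\<close>.  Completeness thus replaces a separation or representation theorem in
  producing the slope of \<open>U\<close>.
\<close>

lemma limit_quad_majorant:
  fixes u :: "nat \<Rightarrow> 'a::{real_inner, complete_space} \<Rightarrow> real"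
  assumes conv: "\<And>n. convex_on UNIV (u n)"
    and inc: "\<And>x. incseq (\<lambda>n. u n x)" and lim: "\<And>x. (\<lambda>n. u n x) \<longlonglongrightarrow> U x"
    and c: "c \<longlonglongrightarrow> c\<^sub>0" and C: "\<And>n. c n \<le> C" "C > 0"
    and maj: "\<And>n e. e > 0 \<Longrightarrow> \<exists>p. quad_majorant (c n) (u n) x (u n x + e) p"
  shows "\<exists>p. quad_majorant c\<^sub>0 U x (U x) p"
proof -
  let ?e = "\<lambda>n. 1 / real (Suc n)"
  have "\<forall>n. \<exists>p. quad_majorant (c n) (u n) x (u n x + ?e n) p" using maj by simp
  then obtain p where p: "\<And>n. quad_majorant (c n) (u n) x (u n x + ?e n) (p n)" by metis
  have uU: "u n y \<le> U y" for n y using inc lim by (rule incseq_le)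
  let ?r = "\<lambda>n. 4 * C * (U x - u n x + 2 * ?e n)"
  have close: "(norm (p n - p m))\<^sup>2 \<le> ?r n" if "n \<le> m" for n m
  proof (rule norm_sq_le_of_quadratic[OF C(2)])
    fix d
    have "u n (x + d) \<le> u n x + ?e n + p n \<bullet> d + C / 2 * (norm d)\<^sup>2"
      using quad_majorant_mono[OF p C(1)] unfolding quad_majorant_def by blast
    moreover have "u n (x - d) \<le> u m (x - d)" by (rule incseqD[OF inc that])
    moreover have "u m (x + (- d)) \<le> u m x + ?e m + p m \<bullet> (- d) + C / 2 * (norm (- d))\<^sup>2"
      using quad_majorant_mono[OF p C(1)] unfolding quad_majorant_def by blast
    moreover have "?e m \<le> ?e n" using that by (simp add: field_simps)
    moreover have "u m x \<le> U x" by (rule uU)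
    moreover have "2 * u n x \<le> u n (x + d) + u n (x - d)" by (rule convex_midpoint[OF conv])
    ultimately show "0 \<le> U x - u n x + 2 * ?e n + (p n - p m) \<bullet> d + C * (norm d)\<^sup>2"
      by (simp add: inner_diff_left)
  qed
  have e0: "?e \<longlonglongrightarrow> 0" by (rule LIMSEQ_Suc[OF lim_const_over_n])
  have "?r \<longlonglongrightarrow> 4 * C * (U x - U x + 2 * 0)"
    by (intro tendsto_intros lim e0)
  then have r0: "?r \<longlonglongrightarrow> 0" by simp
  have "Cauchy p"
  proof (rule CauchyI')
    fix e :: real assume e: "0 < e"
    then have "eventually (\<lambda>n. ?r n < e\<^sup>2) sequentially"
      using r0 by (intro order_tendstoD(2)[OF r0]) auto
    then obtain N where N: "\<And>n. n \<ge> N \<Longrightarrow> ?r n < e\<^sup>2" by (auto simp: eventually_sequentially)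
    have "dist (p n) (p m) < e" if "N \<le> n" "n < m" for n m
    proof -
      have "(norm (p n - p m))\<^sup>2 < e\<^sup>2" using close[of n m] N[of n] that by linarith
      then show ?thesis using e by (simp add: dist_norm power_less_imp_less_base)
    qed
    then show "\<exists>N. \<forall>n\<ge>N. \<forall>m>n. dist (p n) (p m) < e" by blast
  qed
  then obtain P where P: "p \<longlonglongrightarrow> P" using Cauchy_convergent convergent_def by blast
  have "U (x + d) \<le> U x + P \<bullet> d + c\<^sub>0 / 2 * (norm d)\<^sup>2" for d
  proof (rule tendsto_le[OF sequentially_bot _ lim])
    have "(\<lambda>n. u n x + ?e n + p n \<bullet> d + c n / 2 * (norm d)\<^sup>2)
        \<longlonglongrightarrow> U x + 0 + P \<bullet> d + c\<^sub>0 / 2 * (norm d)\<^sup>2"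
      by (intro tendsto_intros lim e0 P c)  simp
    then show "(\<lambda>n. u n x + ?e n + p n \<bullet> d + c n / 2 * (norm d)\<^sup>2)
        \<longlonglongrightarrow> U x + P \<bullet> d + c\<^sub>0 / 2 * (norm d)\<^sup>2" by simp
    show "\<forall>\<^sub>F n in sequentially. u n (x + d) \<le> u n x + ?e n + p n \<bullet> d + c n / 2 * (norm d)\<^sup>2"
      using p unfolding quad_majorant_def by simp
  qed
  then show ?thesis unfolding quad_majorant_def by blast
qed

section \<open>The envelope by quadratic majorants\<close>

definition quad_env :: "real \<Rightarrow> ('a::real_inner \<Rightarrow> real) \<Rightarrow> 'a \<Rightarrow> real" where
  "quad_env c f x = Inf {a. \<exists>p. quad_majorant c f x a p}"

text \<open>
  Boundedness by a quadratic of curvature \<open>c\<close> guarantees that the set in the definition of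
  \<open>quad_env\<close> is nonempty at every point.
\<close>

definition quad_bounded :: "real \<Rightarrow> ('a::real_inner \<Rightarrow> real) \<Rightarrow> bool" where
  "quad_bounded c f \<longleftrightarrow> (\<exists>s a p. quad_majorant c f s a p)"

lemma quad_bounded_at:
  assumes "quad_bounded c f"
  shows "\<exists>a p. quad_majorant c f x a p"
proof -
  obtain s a p where "quad_majorant c f s a p" using assms unfolding quad_bounded_def by blast
  from quad_majorant_recenter[OF this, of "x - s"] show ?thesis by auto
qed

lemma quad_majorant_at_center: "quad_majorant c f x a p \<Longrightarrow> f x \<le> a"
  unfolding quad_majorant_def by (drule spec[of _ 0]) simp

lemma bdd_below_majorants: "bdd_below {a. \<exists>p. quad_majorant c f x a p}"
  by (rule bdd_belowI[of _ "f x"]) (auto dest: quad_majorant_at_center)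

lemma quad_env_ge:
  assumes "quad_bounded c f"
  shows "f x \<le> quad_env c f x"
  unfolding quad_env_def
  by (rule cInf_greatest) (use quad_bounded_at[OF assms] in \<open>auto dest: quad_majorant_at_center\<close>)

lemma quad_env_le:
  assumes "quad_majorant c f x a p"
  shows "quad_env c f x \<le> a"
  unfolding quad_env_def by (rule cInf_lower) (use assms bdd_below_majorants in auto)

lemma quad_env_approx:
  assumes "quad_bounded c f" "e > 0"
  obtains a p where "quad_majorant c f x a p" "a < quad_env c f x + e"
proof -
  have "\<exists>a\<in>{a. \<exists>p. quad_majorant c f x a p}. a < quad_env c f x + e"
    unfolding quad_env_def
    by (subst cInf_less_iff[symmetric]) (use assms quad_bounded_at bdd_below_majorants in auto)
  then show ?thesis using that by blast
qed

lemma quad_env_majorant: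
  assumes "quad_majorant c f x a p"
  shows "quad_majorant c (quad_env c f) x a p"
  unfolding quad_majorant_def using quad_env_le[OF quad_majorant_recenter[OF assms]] by blast

lemma quad_env_antimono:
  assumes "quad_bounded c f" "c \<le> c'"
  shows "quad_env c' f x \<le> quad_env c f x"
  unfolding quad_env_def
proof (rule cInf_superset_mono)
  show "{a. \<exists>p. quad_majorant c f x a p} \<noteq> {}" using quad_bounded_at[OF assms(1)] by blast
  show "{a. \<exists>p. quad_majorant c f x a p} \<subseteq> {a. \<exists>p. quad_majorant c' f x a p}"
    using quad_majorant_mono[OF _ assms(2)] by blast
qed (rule bdd_below_majorants)

lemma quad_env_near_majorant:
  assumes "quad_bounded c f" "e > 0"
  shows "\<exists>p. quad_majorant c (quad_env c f) x (quad_env c f x + e) p"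
proof -
  obtain a p where "quad_majorant c f x a p" and a: "a < quad_env c f x + e"
    using quad_env_approx[OF assms] by blast
  then have *: "quad_majorant c (quad_env c f) x a p" by (intro quad_env_majorant)
  have "quad_env c f (x + d) \<le> quad_env c f x + e + p \<bullet> d + c / 2 * (norm d)\<^sup>2" for d
    using *[unfolded quad_majorant_def, rule_format, of d] a by linarith
  then show ?thesis unfolding quad_majorant_def by blast
qed

text \<open>
  If one majorant is centred at \<open>x\<close> and another at \<open>y\<close>, the convex combination of their values
  and slopes gives a majorant centred at the corresponding convex combination of \<open>x\<close> and \<open>y\<close>, by
  convexity of \<open>f\<close> along each common displacement \<open>d\<close>.
\<close>

lemma quad_env_convex:
  fixes f :: "'a::real_inner \<Rightarrow> real"
  assumes f: "convex_on UNIV f" and b: "quad_bounded c f"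
  shows "convex_on UNIV (quad_env c f)"
proof (rule convex_onI)
  fix t :: real and x y :: 'a assume t: "0 < t" "t < 1"
  let ?z = "(1 - t) *\<^sub>R x + t *\<^sub>R y"
  show "quad_env c f ?z \<le> (1 - t) * quad_env c f x + t * quad_env c f y"
  proof (rule field_le_epsilon)
    fix e :: real assume e: "e > 0"
    obtain a p where 1: "quad_majorant c f x a p" "a < quad_env c f x + e"
      using quad_env_approx[OF b e] by blast
    obtain a' p' where 2: "quad_majorant c f y a' p'" "a' < quad_env c f y + e"
      using quad_env_approx[OF b e] by blast
    have "quad_majorant c f ?z ((1 - t) * a + t * a') ((1 - t) *\<^sub>R p + t *\<^sub>R p')"
      unfolding quad_majorant_def
    proof
      fix d
      have "f (?z + d) = f ((1 - t) *\<^sub>R (x + d) + t *\<^sub>R (y + d))" by (simp add: algebra_simps)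
      also have "\<dots> \<le> (1 - t) * f (x + d) + t * f (y + d)"
        using t by (intro convex_onD[OF f]) auto
      also have "\<dots> \<le> (1 - t) * (a + p \<bullet> d + c / 2 * (norm d)\<^sup>2)
          + t * (a' + p' \<bullet> d + c / 2 * (norm d)\<^sup>2)"
        using 1 2 t unfolding quad_majorant_def by (intro add_mono mult_left_mono) auto
      finally show "f (?z + d) \<le> (1 - t) * a + t * a' + ((1 - t) *\<^sub>R p + t *\<^sub>R p') \<bullet> d
          + c / 2 * (norm d)\<^sup>2"
        by (simp add: inner_add_left left_diff_distrib distrib_left diff_divide_distrib)
    qed
    then have "quad_env c f ?z \<le> (1 - t) * a + t * a'" by (rule quad_env_le)
    also have "\<dots> \<le> (1 - t) * (quad_env c f x + e) + t * (quad_env c f y + e)"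
      using 1 2 t by (intro add_mono mult_left_mono) auto
    finally show "quad_env c f ?z \<le> (1 - t) * quad_env c f x + t * quad_env c f y + e"
      by (simp add: algebra_simps)
  qed
qed auto

section \<open>The double convolution is the envelope\<close>

lemma sup_conv_le_iff:
  assumes "\<epsilon> > 0"
  shows "sup_conv \<epsilon> (\<lambda>y. ereal (f y)) z \<le> ereal r \<longleftrightarrow>
    (\<forall>y. f y - (norm (y - z))\<^sup>2 / (2 * \<epsilon>) \<le> r)"
  unfolding sup_conv_def by (simp add: SUP_le_iff)

lemma sup_conv_ge: "ereal (f z) \<le> sup_conv \<epsilon> (\<lambda>y. ereal (f y)) z"
  unfolding sup_conv_def by (rule SUP_upper2[of z]) auto

text \<open>
  Centre and slope of a majorant correspond to the point at which the sup-convolution is evaluated: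
  the parabola of curvature \<open>1 / \<epsilon>\<close> with vertex \<open>x - \<epsilon> p\<close> has slope \<open>p\<close> at \<open>x\<close>, and the
  subtracted term is the height of that parabola at \<open>x\<close> above its vertex.
\<close>

lemma sup_conv_le_iff_majorant:
  assumes "\<epsilon> > 0"
  shows "sup_conv \<epsilon> (\<lambda>y. ereal (f y)) (x - \<epsilon> *\<^sub>R p) \<le> ereal (a - \<epsilon> / 2 * (norm p)\<^sup>2) \<longleftrightarrow>
    quad_majorant (1 / \<epsilon>) f x a p"
proof -
  have *: "(norm (d + \<epsilon> *\<^sub>R p))\<^sup>2 / (2 * \<epsilon>)
      = p \<bullet> d + (1 / \<epsilon>) / 2 * (norm d)\<^sup>2 + \<epsilon> / 2 * (norm p)\<^sup>2" for d
    unfolding norm_add_sq using assms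
    by (simp add: power_mult_distrib inner_commute add_divide_distrib) (simp add: power2_eq_square)
  have "(\<forall>y. f y - (norm (y - (x - \<epsilon> *\<^sub>R p)))\<^sup>2 / (2 * \<epsilon>) \<le> a - \<epsilon> / 2 * (norm p)\<^sup>2) \<longleftrightarrow>
    (\<forall>d. f (x + d) - (norm (d + \<epsilon> *\<^sub>R p))\<^sup>2 / (2 * \<epsilon>) \<le> a - \<epsilon> / 2 * (norm p)\<^sup>2)"
    (is "(\<forall>y. ?P y) \<longleftrightarrow> (\<forall>d. ?Q d)")
  proof -
    have "?Q d \<longleftrightarrow> ?P (x + d)" for d by (simp add: algebra_simps)
    then show ?thesis by (metis add.commute diff_add_cancel)
  qed
  then show ?thesis unfolding sup_conv_le_iff[OF assms] quad_majorant_def * by (simp add: algebra_simps)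
qed

text \<open>
  The penalty of the outer infimum at \<open>z = x - \<epsilon> p\<close> is \<open>\<epsilon> / 2 * |p|\<^sup>2\<close>, exactly the amount
  subtracted in \<open>sup_conv_le_iff_majorant\<close>, and every \<open>z\<close> has this form.
\<close>

lemma inf_sup_conv_eq_quad_env:
  assumes e: "\<epsilon> > 0" and b: "quad_bounded (1 / \<epsilon>) f"
  shows "inf_conv \<epsilon> (sup_conv \<epsilon> (\<lambda>y. ereal (f y))) x = ereal (quad_env (1 / \<epsilon>) f x)"
proof (rule antisym)
  let ?s = "sup_conv \<epsilon> (\<lambda>y. ereal (f y))"
  let ?A = "{a. \<exists>p. quad_majorant (1 / \<epsilon>) f x a p}"
  have pen: "(norm (x - \<epsilon> *\<^sub>R p - x))\<^sup>2 / (2 * \<epsilon>) = \<epsilon> / 2 * (norm p)\<^sup>2" for p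
    using e by (simp add: power_mult_distrib power2_eq_square)
  have "inf_conv \<epsilon> ?s x \<le> ereal a" if a: "a \<in> ?A" for a
  proof -
    obtain p where "quad_majorant (1 / \<epsilon>) f x a p" using a by blast
    then have "?s (x - \<epsilon> *\<^sub>R p) \<le> ereal (a - \<epsilon> / 2 * (norm p)\<^sup>2)"
      using sup_conv_le_iff_majorant[OF e] by blast
    then have "?s (x - \<epsilon> *\<^sub>R p) + ereal (\<epsilon> / 2 * (norm p)\<^sup>2)
        \<le> ereal (a - \<epsilon> / 2 * (norm p)\<^sup>2) + ereal (\<epsilon> / 2 * (norm p)\<^sup>2)" by (rule add_right_mono)
    also have "\<dots> = ereal a" by simp
    finally show ?thesis unfolding inf_conv_def
      by (intro INF_lower2[of "x - \<epsilon> *\<^sub>R p"]) (simp_all only: pen UNIV_I)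
  qed
  then have "inf_conv \<epsilon> ?s x \<le> (INF a\<in>?A. ereal a)" by (rule INF_greatest)
  also have "\<dots> = ereal (Inf ?A)"
    by (rule ereal_Inf'[symmetric, OF bdd_below_majorants]) (use quad_bounded_at[OF b] in blast)
  finally show "inf_conv \<epsilon> ?s x \<le> ereal (quad_env (1 / \<epsilon>) f x)"
    unfolding quad_env_def .
  show "ereal (quad_env (1 / \<epsilon>) f x) \<le> inf_conv \<epsilon> ?s x"
    unfolding inf_conv_def
  proof (rule INF_greatest)
    fix z
    define p where "p = (1 / \<epsilon>) *\<^sub>R (x - z)"
    have z: "z = x - \<epsilon> *\<^sub>R p" using e by (simp add: p_def)
    show "ereal (quad_env (1 / \<epsilon>) f x) \<le> ?s z + ereal ((norm (z - x))\<^sup>2 / (2 * \<epsilon>))"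
    proof (cases "?s z")
      case (real r)
      then have "?s (x - \<epsilon> *\<^sub>R p) \<le> ereal ((r + \<epsilon> / 2 * (norm p)\<^sup>2) - \<epsilon> / 2 * (norm p)\<^sup>2)"
        using z by simp
      then have "quad_env (1 / \<epsilon>) f x \<le> r + \<epsilon> / 2 * (norm p)\<^sup>2"
        using sup_conv_le_iff_majorant[OF e] quad_env_le by blast
      then show ?thesis unfolding real using pen[of p] z by simp
    next
      case MInf
      then show ?thesis using sup_conv_ge[of f z \<epsilon>] by simp
    qed simp
  qed
qed

text \<open>
  The majorant has curvature strictly below that of the penalty, so the difference of the two is a
  downward parabola, which is bounded above.
\<close>

lemma sup_conv_finite:
  assumes e: "\<epsilon> > 0" "c < 1 / \<epsilon>" and b: "quad_bounded c f"
  shows "\<bar>sup_conv \<epsilon> (\<lambda>y. ereal (f y)) x\<bar> \<noteq> \<infinity>"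
proof -
  obtain a p where ap: "quad_majorant c f x a p" using quad_bounded_at[OF b] by blast
  define k where "k = 1 / \<epsilon> - c"
  have k: "k > 0" using e by (simp add: k_def)
  have "sup_conv \<epsilon> (\<lambda>y. ereal (f y)) x \<le> ereal (a + (norm p)\<^sup>2 / (2 * k))"
    unfolding sup_conv_le_iff[OF e(1)]
  proof
    fix y
    let ?d = "y - x"
    have "f (x + ?d) \<le> a + p \<bullet> ?d + c / 2 * (norm ?d)\<^sup>2"
      using ap unfolding quad_majorant_def by blast
    moreover have "(norm ?d)\<^sup>2 / (2 * \<epsilon>) = c / 2 * (norm ?d)\<^sup>2 + k / 2 * (norm ?d)\<^sup>2"
      using e by (simp add: k_def field_simps)
    moreover have "p \<bullet> ?d - k / 2 * (norm ?d)\<^sup>2 \<le> (norm p)\<^sup>2 / (2 * k)"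
      by (rule inner_minus_square_le[OF k])
    ultimately show "f y - (norm ?d)\<^sup>2 / (2 * \<epsilon>) \<le> a + (norm p)\<^sup>2 / (2 * k)" by simp
  qed
  then show ?thesis using sup_conv_ge[of f x \<epsilon>]
    by (cases "sup_conv \<epsilon> (\<lambda>y. ereal (f y)) x") auto
qed

lemma inf_sup_conv_joint:
  "(INF z. SUP y. ereal (f y - (norm (y - z))\<^sup>2 / (2 * \<epsilon>) + (norm (z - x))\<^sup>2 / (2 * \<epsilon>)))
    = inf_conv \<epsilon> (sup_conv \<epsilon> (\<lambda>y. ereal (f y))) x"
  unfolding inf_conv_def sup_conv_def
  by (subst SUP_ereal_add_left[symmetric]) auto

section \<open>The limit of the envelopes\<close>

text \<open>
  The envelopes increase as \<open>c\<close> decreases to \<open>M\<close>, so their limit is a supremum.  The value \<open>c = M\<close>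
  itself is left out because it corresponds to the excluded parameter \<open>\<epsilon> = 1 / M\<close>.
\<close>

definition env_limit :: "real \<Rightarrow> ('a::real_inner \<Rightarrow> real) \<Rightarrow> 'a \<Rightarrow> real" where
  "env_limit M f x = (SUP c\<in>{M<..}. quad_env c f x)"

lemma quad_env_le_of_majorant:
  assumes "quad_majorant M f x a p" "M \<le> c"
  shows "quad_env c f x \<le> a"
  by (rule quad_env_le[OF quad_majorant_mono[OF assms]])

lemma quad_bounded_mono: "quad_bounded M f \<Longrightarrow> M \<le> c \<Longrightarrow> quad_bounded c f"
  unfolding quad_bounded_def using quad_majorant_mono by blast

lemma bdd_above_envs:
  assumes "quad_bounded M f"
  shows "bdd_above ((\<lambda>c. quad_env c f x) ` {M<..})"
proof -
  obtain a p where "quad_majorant M f x a p" using quad_bounded_at[OF assms] by blast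
  then show ?thesis by (intro bdd_aboveI[of _ a]) (auto intro: quad_env_le_of_majorant)
qed

lemma quad_env_tendsto:
  assumes b: "quad_bounded M f"
  shows "((\<lambda>c. quad_env c f x) \<longlongrightarrow> env_limit M f x) (at_right M)"
proof (rule increasing_tendsto)
  show "\<forall>\<^sub>F c in at_right M. quad_env c f x \<le> env_limit M f x"
    unfolding env_limit_def
    by (rule eventually_at_right_less[THEN eventually_mono]) (auto intro!: cSUP_upper bdd_above_envs[OF b])
next
  fix r assume "r < env_limit M f x"
  then obtain c where c: "M < c" "r < quad_env c f x"
    unfolding env_limit_def by (subst (asm) less_cSUP_iff[OF _ bdd_above_envs[OF b]]) auto
  show "\<forall>\<^sub>F c in at_right M. r < quad_env c f x"
    unfolding eventually_at_right_field
  proof (intro exI[of _ c] conjI c(1) allI impI)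
    fix c' assume "M < c'" "c' < c"
    then have "quad_env c f x \<le> quad_env c' f x"
      by (intro quad_env_antimono quad_bounded_mono[OF b]) auto
    then show "r < quad_env c' f x" using c by simp
  qed
qed

lemma env_limit_ge:
  assumes "quad_bounded M f"
  shows "f x \<le> env_limit M f x"
proof -
  have "f x \<le> quad_env (M + 1) f x" by (intro quad_env_ge quad_bounded_mono[OF assms]) simp
  also have "\<dots> \<le> env_limit M f x"
    unfolding env_limit_def by (intro cSUP_upper bdd_above_envs[OF assms]) auto
  finally show ?thesis .
qed

lemma env_limit_majorant:
  assumes "quad_majorant M f x a p"
  shows "quad_majorant M (env_limit M f) x a p"
  unfolding quad_majorant_def env_limit_def
  by (intro allI cSUP_least)
    (use quad_env_le_of_majorant[OF quad_majorant_recenter[OF assms]] in auto)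

lemma quad_env_LIMSEQ:
  fixes f :: "'a::real_inner \<Rightarrow> real"
  assumes "quad_bounded M f"
  shows "(\<lambda>n. quad_env (M + 1 / real (Suc n)) f x) \<longlonglongrightarrow> env_limit M f x"
proof -
  have "(\<lambda>n. M + 1 / real (Suc n)) \<longlonglongrightarrow> M + 0"
    by (intro tendsto_intros LIMSEQ_Suc[OF lim_const_over_n])
  then have "filterlim (\<lambda>n. M + 1 / real (Suc n)) (at_right M) sequentially"
    unfolding filterlim_at by auto
  then show ?thesis by (rule filterlim_compose[OF quad_env_tendsto[OF assms]])
qed

lemma env_limit_convex:
  fixes f :: "'a::real_inner \<Rightarrow> real"
  assumes f: "convex_on UNIV f" and b: "quad_bounded M f"
  shows "convex_on UNIV (env_limit M f)"
proof (rule convex_onI)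
  fix t :: real and x y :: 'a assume t: "0 < t" "t < 1"
  let ?z = "(1 - t) *\<^sub>R x + t *\<^sub>R y" and ?c = "\<lambda>n. M + 1 / real (Suc n)"
  have *: "(\<lambda>n. (1 - t) * quad_env (?c n) f x + t * quad_env (?c n) f y)
      \<longlonglongrightarrow> (1 - t) * env_limit M f x + t * env_limit M f y"
    by (intro tendsto_intros quad_env_LIMSEQ[OF b])
  have "quad_env (?c n) f ?z \<le> (1 - t) * quad_env (?c n) f x + t * quad_env (?c n) f y" for n
    using t by (intro convex_onD[OF quad_env_convex[OF f quad_bounded_mono[OF b]]]) auto
  then show "env_limit M f ?z \<le> (1 - t) * env_limit M f x + t * env_limit M f y"
    by (intro LIMSEQ_le[OF quad_env_LIMSEQ[OF b] *]) auto
qed auto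

lemma env_limit_supports:
  fixes f :: "'a::{real_inner, complete_space} \<Rightarrow> real"
  assumes f: "convex_on UNIV f" and b: "quad_bounded M f" and M: "M > 0"
  shows "\<exists>p. quad_majorant M (env_limit M f) x (env_limit M f x) p"
proof (rule limit_quad_majorant)
  let ?c = "\<lambda>n. M + 1 / real (Suc n)"
  have bn: "quad_bounded (?c n) f" for n by (rule quad_bounded_mono[OF b]) simp
  show "convex_on UNIV (quad_env (?c n) f)" for n by (rule quad_env_convex[OF f bn])
  show "incseq (\<lambda>n. quad_env (?c n) f y)" for y
    by (rule incseq_SucI, rule quad_env_antimono[OF bn]) (simp add: field_simps)
  show "(\<lambda>n. quad_env (?c n) f y) \<longlonglongrightarrow> env_limit M f y" for y by (rule quad_env_LIMSEQ[OF b])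
  have "?c \<longlonglongrightarrow> M + 0"
    by (intro tendsto_intros LIMSEQ_Suc[OF lim_const_over_n])
  then show "?c \<longlonglongrightarrow> M" by simp
  show "?c n \<le> M + 1" for n by simp
  show "M + 1 > 0" using M by simp
  show "\<exists>p. quad_majorant (?c n) (quad_env (?c n) f) x (quad_env (?c n) f x + e) p"
    if "e > 0" for n e by (rule quad_env_near_majorant[OF bn that])
qed

section \<open>The supremum of the prescribed affine functions\<close>

context
  fixes S :: "'a::real_inner set" and \<alpha> :: "'a \<Rightarrow> real" and v :: "'a \<Rightarrow> 'a" and M :: real
  assumes ne: "S \<noteq> {}" and M: "M > 0"
    and jet: "\<And>s1 s2. s1 \<in> S \<Longrightarrow> s2 \<in> S \<Longrightarrow>
      \<alpha> s2 \<ge> \<alpha> s1 + v s1 \<bullet> (s2 - s1) + 1 / (2 * M) * (norm (v s1 - v s2))\<^sup>2"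
begin

text \<open>
  The hypothesis for \<open>(s, t)\<close> keeps the affine function of \<open>s\<close> at least
  \<open>|v s - v t|\<^sup>2 / (2 M)\<close> below \<open>\<alpha> t\<close> at the point \<open>t\<close>, and by Young's inequality this pays for the excess slope \<open>v s - v t\<close> along \<open>d\<close> up to \<open>M / 2 * |d|\<^sup>2\<close>.
\<close>

lemma jet_affine_le:
  assumes "s \<in> S" "t \<in> S"
  shows "\<alpha> s + v s \<bullet> (t + d - s) \<le> \<alpha> t + v t \<bullet> d + M / 2 * (norm d)\<^sup>2"
proof -
  have "(v s - v t) \<bullet> d - M / 2 * (norm d)\<^sup>2 \<le> (norm (v s - v t))\<^sup>2 / (2 * M)"
    by (rule inner_minus_square_le[OF M])
  moreover have "\<alpha> s + v s \<bullet> (t - s) + (norm (v s - v t))\<^sup>2 / (2 * M) \<le> \<alpha> t"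
    using jet[OF assms] by simp
  moreover have "v s \<bullet> (t + d - s) = v s \<bullet> (t - s) + v s \<bullet> d"
    by (simp add: inner_add_right inner_diff_right)
  moreover have "(v s - v t) \<bullet> d = v s \<bullet> d - v t \<bullet> d" by (rule inner_diff_left)
  ultimately show ?thesis by linarith
qed

lemma jet_bdd_above: "bdd_above ((\<lambda>s. \<alpha> s + v s \<bullet> (x - s)) ` S)"
proof -
  obtain t where t: "t \<in> S" using ne by blast
  show ?thesis using jet_affine_le[OF _ t, of _ "x - t"] by (intro bdd_aboveI) auto
qed

lemma jet_sup_minorant: "s \<in> S \<Longrightarrow> affine_minorant (jet_sup S \<alpha> v) s (\<alpha> s) (v s)"
  unfolding affine_minorant_def jet_sup_def
  by (intro allI cSUP_upper2[OF jet_bdd_above]) auto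

lemma jet_sup_majorant: "s \<in> S \<Longrightarrow> quad_majorant M (jet_sup S \<alpha> v) s (\<alpha> s) (v s)"
  unfolding quad_majorant_def jet_sup_def
  by (intro allI cSUP_least ne jet_affine_le)

lemma jet_sup_quad_bounded: "quad_bounded M (jet_sup S \<alpha> v)"
  unfolding quad_bounded_def using jet_sup_majorant ne by blast

lemma jet_sup_convex: "convex_on UNIV (jet_sup S \<alpha> v)"
proof (rule convex_onI)
  fix t :: real and x y :: 'a assume t: "0 < t" "t < 1"
  let ?f = "jet_sup S \<alpha> v"
  have up: "\<alpha> s + v s \<bullet> (x - s) \<le> ?f x" if "s \<in> S" for s x
    unfolding jet_sup_def by (rule cSUP_upper[OF that jet_bdd_above])
  show "?f ((1 - t) *\<^sub>R x + t *\<^sub>R y) \<le> (1 - t) * ?f x + t * ?f y"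
    unfolding jet_sup_def[of S \<alpha> v "(1 - t) *\<^sub>R x + t *\<^sub>R y"]
  proof (rule cSUP_least[OF ne])
    fix s assume s: "s \<in> S"
    have "\<alpha> s + v s \<bullet> ((1 - t) *\<^sub>R x + t *\<^sub>R y - s)
        = (1 - t) * (\<alpha> s + v s \<bullet> (x - s)) + t * (\<alpha> s + v s \<bullet> (y - s))"
      by (simp add: inner_add_right inner_diff_right algebra_simps)
    also have "\<dots> \<le> (1 - t) * ?f x + t * ?f y"
      using t s by (intro add_mono mult_left_mono up) auto
    finally show "\<alpha> s + v s \<bullet> ((1 - t) *\<^sub>R x + t *\<^sub>R y - s) \<le> (1 - t) * ?f x + t * ?f y" .
  qed
qed auto

end

text \<open>
  In infinite dimension a real-valued convex function may be discontinuous; the two bounds make this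
  one bounded on balls, which suffices.
\<close>

lemma convex_sandwich_continuous:
  assumes f: "convex_on UNIV f" and lo: "affine_minorant f s a p" and up: "quad_majorant c f s a' p'"
  shows "continuous_on UNIV f"
proof -
  have "continuous_on (ball s R) f" for R
  proof (rule convex_on_bounded_continuous)
    show "convex_on (ball s R) f" using convex_on_subset[OF f] by auto
    let ?b = "\<bar>a\<bar> + norm p * R + \<bar>a'\<bar> + norm p' * R + \<bar>c\<bar> / 2 * R\<^sup>2"
    show "\<forall>x\<in>ball s R. \<bar>f x\<bar> \<le> ?b"
    proof
      fix x assume "x \<in> ball s R"
      then have R: "norm (x - s) \<le> R" by (simp add: dist_norm norm_minus_commute)
      then have R0: "0 \<le> R" using norm_ge_zero[of "x - s"] by linarith
      have "a + p \<bullet> (x - s) \<le> f x" "f x \<le> a' + p' \<bullet> (x - s) + c / 2 * (norm (x - s))\<^sup>2"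
        by (rule affine_minorantD[OF lo] quad_majorantD[OF up])+
      moreover have "\<bar>q \<bullet> (x - s)\<bar> \<le> norm q * R" for q
        using Cauchy_Schwarz_ineq2[of q "x - s"] mult_left_mono[OF R norm_ge_zero[of q]] by linarith
      from this[of p] this[of p'] have "- (norm p * R) \<le> p \<bullet> (x - s)" "p' \<bullet> (x - s) \<le> norm p' * R"
        by auto
      moreover have "c / 2 * (norm (x - s))\<^sup>2 \<le> \<bar>c\<bar> / 2 * R\<^sup>2"
        using R by (intro mult_mono power_mono) auto
      moreover have "0 \<le> norm p * R" "0 \<le> norm p' * R" "0 \<le> \<bar>c\<bar> / 2 * R\<^sup>2" using R0 by auto
      ultimately show "\<bar>f x\<bar> \<le> ?b" by linarith
    qed
  qed auto
  then have "continuous_on (\<Union>R. ball s R) f" by (intro continuous_on_open_UN) auto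
  moreover have "(\<Union>R. ball s R) = UNIV" by (auto intro: gt_ex)
  ultimately show ?thesis by simp
qed

lemma extends_jet_sandwich:
  assumes "\<And>s. s \<in> S \<Longrightarrow> affine_minorant h s (\<alpha> s) (v s)"
    and "\<And>s. s \<in> S \<Longrightarrow> quad_majorant c h s (\<alpha> s) (v s)"
  shows "extends_jet S \<alpha> v h"
  unfolding extends_jet_def
proof (intro ballI conjI)
  fix s assume s: "s \<in> S"
  have "\<alpha> s + v s \<bullet> 0 \<le> h (s + 0)" using assms(1)[OF s] unfolding affine_minorant_def by blast
  then show eq: "h s = \<alpha> s" using quad_majorant_at_center[OF assms(2)[OF s]] by simp
  show "GDERIV h s :> v s"
    by (rule GDERIV_sandwich) (use assms s eq in auto)
qed

theorem theorem2p1: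
  fixes S :: "'a::{real_inner, complete_space} set"
    and \<alpha> :: "'a \<Rightarrow> real" and v :: "'a \<Rightarrow> 'a" and M :: real
    and f F :: "'a \<Rightarrow> real"
  defines "f \<equiv> jet_sup S \<alpha> v"
    and "F \<equiv> lim_sup_inf_conv M f"
  assumes "S \<noteq> {}"
    and "M > 0"
    and "\<And>s1 s2. s1 \<in> S \<Longrightarrow> s2 \<in> S \<Longrightarrow>
           \<alpha> s2 \<ge> \<alpha> s1 + v s1 \<bullet> (s2 - s1) + 1 / (2 * M) * (norm (v s1 - v s2))\<^sup>2"
  shows
    "((\<forall>x. bdd_above ((\<lambda>s. \<alpha> s + v s \<bullet> (x - s)) ` S)) \<and>
      continuous_on UNIV f \<and> convex_on UNIV f \<and> extends_jet S \<alpha> v f \<and>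
      (\<forall>g :: 'a \<Rightarrow> real. continuous_on UNIV g \<and> convex_on UNIV g \<and> extends_jet S \<alpha> v g
         \<longrightarrow> (\<forall>x. f x \<le> g x)))
     \<and>
     ((\<forall>\<epsilon> x. 0 < \<epsilon> \<and> \<epsilon> < 1 / M \<longrightarrow>
         \<bar>sup_conv \<epsilon> (\<lambda>y. ereal (f y)) x\<bar> \<noteq> \<infinity> \<and>
         \<bar>inf_conv \<epsilon> (sup_conv \<epsilon> (\<lambda>y. ereal (f y))) x\<bar> \<noteq> \<infinity>) \<and>
      (\<forall>x. ((\<lambda>\<epsilon>. inf_conv \<epsilon> (sup_conv \<epsilon> (\<lambda>y. ereal (f y))) x)
              \<longlongrightarrow> ereal (F x)) (at_left (1 / M))) \<and>
      (\<forall>x. ((\<lambda>\<epsilon>. INF z. SUP y.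
                 ereal (f y - (norm (y - z))\<^sup>2 / (2 * \<epsilon>) + (norm (z - x))\<^sup>2 / (2 * \<epsilon>)))
              \<longlongrightarrow> ereal (F x)) (at_left (1 / M))) \<and>
      convex_on UNIV F \<and>
      (\<forall>x. GDERIV F x :> gradient F x) \<and>
      (\<exists>L. L-lipschitz_on UNIV (gradient F)) \<and>
      extends_jet S \<alpha> v F \<and>
      Lip (gradient F) \<le> M)"
proof -
  note hyps = assms(3-5)
  note M = \<open>M > 0\<close>
  have bdd: "bdd_above ((\<lambda>s. \<alpha> s + v s \<bullet> (x - s)) ` S)" for x by (rule jet_bdd_above[OF hyps])
  have lo: "affine_minorant f s (\<alpha> s) (v s)" if "s \<in> S" for s
    unfolding f_def by (rule jet_sup_minorant[OF hyps that])
  have up: "quad_majorant M f s (\<alpha> s) (v s)" if "s \<in> S" for s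
    unfolding f_def by (rule jet_sup_majorant[OF hyps that])
  have cvx: "convex_on UNIV f" unfolding f_def by (rule jet_sup_convex[OF hyps])
  have b: "quad_bounded M f" unfolding f_def by (rule jet_sup_quad_bounded[OF hyps])
  have cont: "continuous_on UNIV f"
    using convex_sandwich_continuous[OF cvx lo up] \<open>S \<noteq> {}\<close> by blast
  have fjet: "extends_jet S \<alpha> v f" by (rule extends_jet_sandwich[OF lo up])
  have least: "f x \<le> g x" if g: "convex_on UNIV g" "extends_jet S \<alpha> v g" for g x
    unfolding f_def jet_sup_def
  proof (rule cSUP_least[OF \<open>S \<noteq> {}\<close>])
    fix s assume "s \<in> S"
    then have "affine_minorant g s (\<alpha> s) (v s)"
      using convex_tangent_minorant[OF g(1)] g(2) unfolding extends_jet_def by metis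
    then show "\<alpha> s + v s \<bullet> (x - s) \<le> g x"
      by (rule affine_minorantD)
  qed

  have conv_env: "inf_conv \<epsilon> (sup_conv \<epsilon> (\<lambda>y. ereal (f y))) x = ereal (quad_env (1 / \<epsilon>) f x)"
    if "0 < \<epsilon>" "\<epsilon> < 1 / M" for \<epsilon> x
    using that M
    by (intro inf_sup_conv_eq_quad_env quad_bounded_mono[OF b]) (auto simp: field_simps)
  have fin: "\<bar>sup_conv \<epsilon> (\<lambda>y. ereal (f y)) x\<bar> \<noteq> \<infinity> \<and>
      \<bar>inf_conv \<epsilon> (sup_conv \<epsilon> (\<lambda>y. ereal (f y))) x\<bar> \<noteq> \<infinity>" if "0 < \<epsilon>" "\<epsilon> < 1 / M" for \<epsilon> x
    using sup_conv_finite[OF _ _ b, of \<epsilon> x] conv_env[OF that] that M by (simp add: field_simps)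
  have near: "eventually (\<lambda>\<epsilon>. 0 < \<epsilon> \<and> \<epsilon> < 1 / M) (at_left (1 / M))"
    using M by (auto simp: eventually_at_left_field intro!: exI[of _ 0])
  have recip: "filterlim (\<lambda>\<epsilon>. 1 / \<epsilon>) (at_right M) (at_left (1 / M))"
    unfolding filterlim_at
  proof
    show "\<forall>\<^sub>F \<epsilon> in at_left (1 / M). 1 / \<epsilon> \<in> {M<..} \<and> 1 / \<epsilon> \<noteq> M"
      using near by eventually_elim (use M in \<open>auto simp: field_simps\<close>)
    have "((\<lambda>\<epsilon>. 1 / \<epsilon>) \<longlongrightarrow> 1 / (1 / M)) (at_left (1 / M))"
      using M by (intro tendsto_intros) auto
    then show "((\<lambda>\<epsilon>. 1 / \<epsilon>) \<longlongrightarrow> M) (at_left (1 / M))" by simp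
  qed
  have lim: "((\<lambda>\<epsilon>. inf_conv \<epsilon> (sup_conv \<epsilon> (\<lambda>y. ereal (f y))) x) \<longlongrightarrow> ereal (env_limit M f x))
      (at_left (1 / M))" for x
  proof (rule Lim_transform_eventually)
    show "((\<lambda>\<epsilon>. ereal (quad_env (1 / \<epsilon>) f x)) \<longlongrightarrow> ereal (env_limit M f x)) (at_left (1 / M))"
      by (intro tendsto_ereal filterlim_compose[OF quad_env_tendsto[OF b] recip])
    show "\<forall>\<^sub>F \<epsilon> in at_left (1 / M). ereal (quad_env (1 / \<epsilon>) f x)
        = inf_conv \<epsilon> (sup_conv \<epsilon> (\<lambda>y. ereal (f y))) x"
      using near by eventually_elim (simp add: conv_env)
  qed
  have F: "F = env_limit M f"
    unfolding F_def lim_sup_inf_conv_def by (rule ext) (simp add: tendsto_Lim[OF _ lim])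
  have Fcvx: "convex_on UNIV F" unfolding F by (rule env_limit_convex[OF cvx b])
  obtain p where Fup: "\<And>x. quad_majorant M F x (F x) (p x)"
    using env_limit_supports[OF cvx b M] unfolding F by metis
  have Flo: "\<And>x. affine_minorant F x (F x) (p x)" by (rule convex_quad_majorant_tangent[OF Fcvx Fup])
  have der: "GDERIV F x :> p x" for x by (rule GDERIV_sandwich[OF Flo Fup])
  have grad: "gradient F = p" by (rule HOL.ext) (rule gradient_eqI[OF der])
  have lip: "M-lipschitz_on UNIV (gradient F)"
    unfolding grad by (rule supports_lipschitz[OF M Flo Fup])
  have Lip: "Lip (gradient F) \<le> M"
    unfolding Lip_def using lip by (intro cInf_lower bdd_belowI[of _ 0]) (auto simp: lipschitz_on_def)
  have Fjet: "extends_jet S \<alpha> v F"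
  proof (rule extends_jet_sandwich)
    fix s assume s: "s \<in> S"
    show "affine_minorant F s (\<alpha> s) (v s)"
      using lo[OF s] env_limit_ge[OF b] unfolding affine_minorant_def F by (meson order_trans)
    show "quad_majorant M F s (\<alpha> s) (v s)" unfolding F by (rule env_limit_majorant[OF up[OF s]])
  qed
  show ?thesis
    unfolding inf_sup_conv_joint
  proof (intro conjI allI impI)
    fix \<epsilon> x assume "0 < \<epsilon> \<and> \<epsilon> < 1 / M"
    then have \<epsilon>: "0 < \<epsilon>" "\<epsilon> < 1 / M" by auto
    show "\<bar>sup_conv \<epsilon> (\<lambda>y. ereal (f y)) x\<bar> \<noteq> \<infinity>"
      by (rule conjunct1[OF fin[OF \<epsilon>]])
    show "\<bar>inf_conv \<epsilon> (sup_conv \<epsilon> (\<lambda>y. ereal (f y))) x\<bar> \<noteq> \<infinity>"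
      by (rule conjunct2[OF fin[OF \<epsilon>]])
  next
    fix x
    \<comment> \<open>After the rewriting above, both limit formulas are literally the same goal.\<close>
    show "((\<lambda>\<epsilon>. inf_conv \<epsilon> (sup_conv \<epsilon> (\<lambda>y. ereal (f y))) x) \<longlongrightarrow> ereal (F x)) (at_left (1 / M))"
      unfolding F by (rule lim)
    then show "((\<lambda>\<epsilon>. inf_conv \<epsilon> (sup_conv \<epsilon> (\<lambda>y. ereal (f y))) x) \<longlongrightarrow> ereal (F x)) (at_left (1 / M))" .
    show "GDERIV F x :> gradient F x" unfolding grad by (rule der)
  next
    fix g x assume "continuous_on UNIV g \<and> convex_on UNIV g \<and> extends_jet S \<alpha> v g"
    then show "f x \<le> g x" using least by blast
  next
    show "\<exists>L. L-lipschitz_on UNIV (gradient F)" by (rule exI) (rule lip)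
  qed (rule bdd cont cvx fjet Fcvx Fjet Lip)+
qed

end
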